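(* Let $g\in\mathcal{D}^0\cap\mathcal{K}^0$ and let $a,b\in\mathbb{N}^*$ with $a<b$. Then $$\Sigma g\left(\frac ab\right)=\frac1b\sum_{j=0}^{b-1}\left(1-\omega_b^{-aj}\right)S^b_j[g],$$ where $$\omega_b=e^{\frac{2\pi i}{b}}\qquad\text{and}\qquad S^b_j[g]=\sum_{k=1}^{\infty}\omega_b^{jk}\,g\left(\frac kb\right).$$
   Context: $\mathbb{N}^*=\{1,2,\ldots\}$, $\mathbb{R}_+=(0,\infty)$. $\mathcal{K}^0$ is the set of functions $\mathbb{R}_+\to\mathbb{R}$ that are eventually monotone, i.e., increasing or decreasing (in the wide sense) in a neighborhood of infinity, and $\mathcal{D}^0\cap\mathcal{K}^0$ is the set of functions $g\in\mathcal{K}^0$ such that $g(n)\to0$ as $n\to\infty$ over the integers (equivalently, for $g\in\mathcal{K}^0$, $g(x)\to 0$ as $x\to\infty$ over the reals). For $g\in\mathcal{D}^0\cap\mathcal{K}^0$, the function $\Sigma g\colon\mathbb{R}_+\to\mathbb{R}$ is defined by $$\Sigma g(x)=\lim_{n\to\infty}\Big(-g(x)+\sum_{k=1}^{n-1}(g(k)-g(x+k))\Big),\qquad x>0$$ (the limit exists for every $x>0$); it is the unique eventually monotone solution $f\colon\mathbb{R}_+\to\mathbb{R}$ of $f(x+1)-f(x)=g(x)$ with $f(1)=0$. *)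

theory Defs
  imports Complex_Main
begin

text \<open>
  A function on the positive half-line is represented by a total function of type
  \<^typ>\<open>real \<Rightarrow> real\<close>; all the notions below only look at its values at positive arguments.
\<close>

definition K0 :: "(real \<Rightarrow> real) set" where
  "K0 = {g. \<exists>c>0. mono_on {c<..} g \<or> antimono_on {c<..} g}"

definition D0 :: "(real \<Rightarrow> real) set" where
  "D0 = {g. (\<lambda>n::nat. g (real n)) \<longlonglongrightarrow> 0}"

text \<open>The limit exists for every \<open>x > 0\<close> as soon as \<open>g\<close> belongs to \<open>D0 \<inter> K0\<close>.\<close>

definition Sigma_fun :: "(real \<Rightarrow> real) \<Rightarrow> real \<Rightarrow> real" where
  "Sigma_fun g x = lim (\<lambda>n::nat. - g x + (\<Sum>k=1..<n. g (real k) - g (x + real k)))"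

definition omega :: "nat \<Rightarrow> complex" where
  "omega b = exp (2 * complex_of_real pi * \<i> / of_nat b)"

text \<open>The series starts at \<open>k = 1\<close>: its term with index \<open>k\<close> is \<open>S_term b j g (k - 1)\<close>.\<close>

definition S_term :: "nat \<Rightarrow> nat \<Rightarrow> (real \<Rightarrow> real) \<Rightarrow> nat \<Rightarrow> complex" where
  "S_term b j g m = omega b ^ (j * Suc m) * complex_of_real (g (real (Suc m) / real b))"

text \<open>
  For \<open>j = 0\<close> the series may diverge, and the value is then unspecified. In the theorem this term
  carries the factor \<open>1 - 1 = 0\<close>.
\<close>

definition S_sum :: "nat \<Rightarrow> nat \<Rightarrow> (real \<Rightarrow> real) \<Rightarrow> complex" where
  "S_sum b j g = (\<Sum>m. S_term b j g m)"

end

theory Submission imports Defs begin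

text \<open>
  The average of \<open>\<omega> ^ (j * n)\<close> over \<open>0 \<le> j < b\<close>, where \<open>\<omega> = exp (2 * \<pi> * \<i> / b)\<close>, is \<open>1\<close> or \<open>0\<close>
  according to whether \<open>b\<close> divides \<open>n\<close> (\<open>sum_omega_powers\<close>). Hence averaging
  \<open>(1 - \<omega> powi (- a * j)) * \<omega> ^ (j * k)\<close> over \<open>j\<close> gives the indicator of \<open>k \<equiv> 0\<close> minus the indicator of
  \<open>k \<equiv> a\<close> modulo \<open>b\<close>. Applied to the weights \<open>g (k / b)\<close>, this turns the right-hand side, once its
  terms are grouped into blocks of \<open>b\<close>, into the series with terms \<open>g (q + 1) - g (a / b + q)\<close>
  (\<open>root_of_unity_block\<close>). Its partial sum of length \<open>n\<close> exceeds the expression whose limit is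
  \<open>\<Sigma>g (a / b)\<close> by \<open>g n\<close>, which tends to \<open>0\<close>.

  Exchanging the sum over \<open>j\<close> with the infinite series requires every series \<open>S\<^sub>j\<close> with
  \<open>0 < j < b\<close> to converge. This is Dirichlet's test: the powers of \<open>\<omega>\<^sup>j \<noteq> 1\<close> have bounded partial
  sums, and \<open>g (k / b)\<close> is eventually monotone with limit \<open>0\<close> (\<open>summable_S_term\<close>). For \<open>j = 0\<close> the series may diverge,
  but there every term carries the factor \<open>1 - 1 = 0\<close>.
\<close>

section \<open>Dirichlet's test\<close>

lemma sum_by_parts:
  fixes c u :: "nat \<Rightarrow> 'a::comm_ring"
  shows "(\<Sum>k<n. c k * u k) =
    (\<Sum>k<n. c k) * u n + (\<Sum>k<n. (\<Sum>i\<le>k. c i) * (u k - u (Suc k)))"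
  by (induction n) (simp_all add: algebra_simps lessThan_Suc_atMost[symmetric])

text \<open>
  In the summation by parts, the boundary term vanishes in the limit and the remaining series is
  dominated by a multiple of the total variation of \<open>u\<close>. Bounded variation instead of monotonicity
  treats increasing and decreasing \<open>u\<close> alike.
\<close>

lemma Dirichlet_test_bounded_variation:
  fixes c u :: "nat \<Rightarrow> 'a::{real_normed_field, banach}"
  assumes bound: "\<And>n. norm (\<Sum>k<n. c k) \<le> B"
    and lim: "u \<longlonglongrightarrow> 0"
    and var: "summable (\<lambda>k. norm (u k - u (Suc k)))"
  shows "summable (\<lambda>k. c k * u k)"
proof -
  have boundary: "(\<lambda>n. (\<Sum>k<n. c k) * u n) \<longlonglongrightarrow> 0"
    by (rule tendsto_0_le[OF lim, of _ B])
      (simp add: norm_mult mult.commute[of _ B] mult_right_mono bound)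
  have "summable (\<lambda>k. (\<Sum>i\<le>k. c i) * (u k - u (Suc k)))"
  proof (rule summable_comparison_test')
    show "summable (\<lambda>k. B * norm (u k - u (Suc k)))"
      using var by (rule summable_mult)
    show "norm ((\<Sum>i\<le>k. c i) * (u k - u (Suc k))) \<le> B * norm (u k - u (Suc k))" for k
      using bound[of "Suc k"] by (simp add: norm_mult mult_right_mono lessThan_Suc_atMost)
  qed
  then have "convergent (\<lambda>n. \<Sum>k<n. (\<Sum>i\<le>k. c i) * (u k - u (Suc k)))"
    by (simp add: summable_iff_convergent)
  with boundary show ?thesis
    unfolding summable_iff_convergent sum_by_parts[of c u]
    by (intro convergent_add) (auto simp: convergent_def)
qed

section \<open>Eventually monotone functions vanishing at infinity\<close>

text \<open>
  As soon as \<open>\<lfloor>x\<rfloor> > c\<close>, the value at \<open>x\<close> lies between those at the integers \<open>\<lfloor>x\<rfloor>\<close> and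
  \<open>\<lfloor>x\<rfloor> + 1\<close>.
\<close>

lemma mono_on_tendsto_at_top:
  fixes g :: "real \<Rightarrow> real"
  assumes mono: "mono_on {c<..} g" and lim: "(\<lambda>n. g (real n)) \<longlonglongrightarrow> l"
  shows "(g \<longlongrightarrow> l) at_top"
proof (rule tendsto_sandwich)
  have fl: "filterlim (\<lambda>x::real. nat \<lfloor>x\<rfloor>) sequentially at_top"
    by (rule filterlim_compose[OF filterlim_nat_sequentially filterlim_floor_sequentially])
  show "((\<lambda>x::real. g (real (nat \<lfloor>x\<rfloor>))) \<longlongrightarrow> l) at_top"
    using filterlim_compose[OF lim fl] by simp
  show "((\<lambda>x::real. g (real (Suc (nat \<lfloor>x\<rfloor>)))) \<longlongrightarrow> l) at_top"
    using filterlim_compose[OF LIMSEQ_Suc[OF lim] fl] by simp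
  have large: "\<forall>\<^sub>F x in at_top. x \<ge> max 1 (c + 1)" by (rule eventually_ge_at_top)
  show "\<forall>\<^sub>F x in at_top. g (real (nat \<lfloor>x\<rfloor>)) \<le> g x"
    using large by eventually_elim (rule mono_onD[OF mono]; simp; linarith)
  show "\<forall>\<^sub>F x in at_top. g x \<le> g (real (Suc (nat \<lfloor>x\<rfloor>)))"
    using large by eventually_elim (rule mono_onD[OF mono]; simp; linarith)
qed

text \<open>A sign \<open>s\<close> reduces the decreasing case to the increasing one.\<close>

lemma mono_on_or_antimono_on_cases:
  fixes g :: "real \<Rightarrow> real"
  assumes "mono_on A g \<or> antimono_on A g"
  obtains s :: real where "s = 1 \<or> s = -1" "mono_on A (\<lambda>x. s * g x)"
  using assms by (force simp: monotone_on_def)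

lemma D0_K0_tendsto_at_top:
  assumes "g \<in> D0 \<inter> K0"
  shows "(g \<longlongrightarrow> 0) at_top"
proof -
  from assms obtain c where "mono_on {c<..} g \<or> antimono_on {c<..} g"
    by (auto simp: K0_def)
  then obtain s :: real where s: "s = 1 \<or> s = -1" and mono: "mono_on {c<..} (\<lambda>x. s * g x)"
    by (rule mono_on_or_antimono_on_cases)
  have "(\<lambda>n. s * g (real n)) \<longlonglongrightarrow> 0"
    using assms by (auto simp: D0_def intro: tendsto_mult_right_zero)
  then have "((\<lambda>x. s * g x) \<longlongrightarrow> 0) at_top"
    by (rule mono_on_tendsto_at_top[OF mono])
  then have "((\<lambda>x. s * (s * g x)) \<longlongrightarrow> 0) at_top"
    by (rule tendsto_mult_right_zero)
  with s show ?thesis by auto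
qed

lemma filterlim_Suc_over_at_top:
  assumes "b > 0"
  shows "filterlim (\<lambda>m. real (Suc m) / real b) at_top sequentially"
proof -
  have "filterlim (\<lambda>m. real (Suc m) * (1 / real b)) at_top sequentially"
    using assms by (intro filterlim_at_top_mult_tendsto_pos[OF tendsto_const]
        filterlim_compose[OF filterlim_real_sequentially filterlim_Suc]) auto
  then show ?thesis by simp
qed

text \<open>From some index on the differences have constant sign, so their absolute values telescope.\<close>

lemma D0_K0_bounded_variation:
  assumes g: "g \<in> D0 \<inter> K0" and b: "b > 0"
  shows "summable (\<lambda>m. \<bar>g (real (Suc m) / real b) - g (real (Suc (Suc m)) / real b)\<bar>)"
proof -
  let ?u = "\<lambda>m. g (real (Suc m) / real b)"
  from g obtain c where "mono_on {c<..} g \<or> antimono_on {c<..} g"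
    by (auto simp: K0_def)
  then obtain s :: real where s: "s = 1 \<or> s = -1" and mono: "mono_on {c<..} (\<lambda>x. s * g x)"
    by (rule mono_on_or_antimono_on_cases)
  have "?u \<longlonglongrightarrow> 0"
    by (rule filterlim_compose[OF D0_K0_tendsto_at_top[OF g] filterlim_Suc_over_at_top[OF b]])
  then have "summable (\<lambda>m. s * (?u (Suc m) - ?u m))"
    by (intro summable_mult telescope_summable)
  moreover have "\<forall>\<^sub>F m in sequentially. c < real (Suc m) / real b"
    using filterlim_Suc_over_at_top[OF b] by (simp add: filterlim_at_top_dense)
  then have "\<forall>\<^sub>F m in sequentially. norm \<bar>?u m - ?u (Suc m)\<bar> \<le> s * (?u (Suc m) - ?u m)"
  proof eventually_elim
    case (elim m)
    have le: "real (Suc m) / real b \<le> real (Suc (Suc m)) / real b"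
      by (simp add: divide_right_mono)
    have "s * ?u m \<le> s * ?u (Suc m)"
      using elim le by (intro mono_onD[OF mono]) auto
    then show ?case using s by auto
  qed
  ultimately show ?thesis by (rule summable_comparison_test_ev[rotated])
qed

section \<open>Roots of unity\<close>

lemma omega_power_eq_cis: "omega b ^ n = cis (2 * pi * real n / real b)"
  unfolding omega_def exp_of_nat_mult[symmetric] by (simp add: cis_conv_exp mult_ac)

lemma omega_neq_0: "omega b \<noteq> 0"
  by (simp add: omega_def)

lemma omega_power_order: "b > 0 \<Longrightarrow> omega b ^ b = 1"
  by (simp add: omega_power_eq_cis)

lemma omega_power_mod:
  assumes "b > 0"
  shows "omega b ^ (n mod b) = omega b ^ n"
proof -
  have "omega b ^ n = omega b ^ (b * (n div b) + n mod b)" by simp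
  also have "\<dots> = omega b ^ (n mod b)"
    unfolding power_add power_mult omega_power_order[OF assms] by simp
  finally show ?thesis by simp
qed

lemma omega_power_eq_1_iff:
  assumes "b > 0"
  shows "omega b ^ n = 1 \<longleftrightarrow> b dvd n"
proof -
  have inj: "inj_on (\<lambda>k. cis (2 * pi * real k / real b)) {..<b}"
    using bij_betw_roots_unity[OF assms] by (rule bij_betw_imp_inj_on)
  have "omega b ^ n = 1 \<longleftrightarrow> omega b ^ (n mod b) = omega b ^ 0"
    by (simp add: omega_power_mod[OF assms])
  also have "\<dots> \<longleftrightarrow> n mod b = 0"
    unfolding omega_power_eq_cis using assms by (intro inj_on_eq_iff[OF inj]) auto
  finally show ?thesis by (simp add: mod_eq_0_iff_dvd)
qed

lemma sum_omega_powers: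
  assumes "b > 0"
  shows "(\<Sum>j<b. omega b ^ (j * n)) = (if b dvd n then of_nat b else 0)"
proof (cases "b dvd n")
  case True
  then have "omega b ^ (j * n) = 1" for j
    by (simp add: omega_power_eq_1_iff[OF assms])
  with True show ?thesis by simp
next
  case False
  then have "omega b ^ n \<noteq> 1"
    by (simp add: omega_power_eq_1_iff[OF assms])
  moreover have "(\<Sum>j<b. omega b ^ (j * n)) = (\<Sum>j<b. (omega b ^ n) ^ j)"
    by (simp add: power_mult[symmetric] mult.commute)
  moreover have "(omega b ^ n) ^ b = 1"
    by (simp add: power_mult[symmetric] omega_power_eq_1_iff[OF assms])
  ultimately show ?thesis using False by (simp add: geometric_sum)
qed

text \<open>
  Since \<open>\<omega> ^ b = 1\<close>, the negative exponent can be shifted by a multiple of \<open>b\<close>. This keeps all exponents of \<open>\<omega>\<close> natural numbers, also in the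
  products with \<open>\<omega> ^ (j * k)\<close> where \<open>k < a\<close>.
\<close>

lemma omega_powi_minus:
  assumes "a < b"
  shows "omega b powi (- int (a * j)) = omega b ^ (j * (b - a))"
proof -
  have "omega b ^ (j * (b - a)) * omega b ^ (a * j) = omega b ^ (j * b)"
    using assms by (simp add: power_add[symmetric] algebra_simps)
  also have "\<dots> = 1" using assms by (simp add: omega_power_eq_1_iff)
  finally have "inverse (omega b ^ (a * j)) = omega b ^ (j * (b - a))"
    by (intro inverse_unique) (simp add: mult.commute)
  then show ?thesis
    unfolding power_int_minus power_int_of_nat .
qed

section \<open>The series of the theorem\<close>

lemma norm_geometric_sum_le:
  fixes z :: "'a::real_normed_field"
  assumes "norm z = 1" "z \<noteq> 1"
  shows "norm (\<Sum>m<n. z ^ Suc m) \<le> 2 / norm (z - 1)"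
proof -
  have "(\<Sum>m<n. z ^ Suc m) = z * ((z ^ n - 1) / (z - 1))"
    using assms by (simp add: sum_distrib_left[symmetric] geometric_sum)
  then have "norm (\<Sum>m<n. z ^ Suc m) = norm (z ^ n - 1) / norm (z - 1)"
    using assms by (simp add: norm_mult norm_divide)
  also have "norm (z ^ n - 1) \<le> 2"
    using norm_triangle_ineq4[of "z ^ n" 1] assms by (simp add: norm_power)
  finally show ?thesis by (simp add: divide_right_mono)
qed

lemma summable_S_term:
  assumes g: "g \<in> D0 \<inter> K0" and j: "0 < j" "j < b"
  shows "summable (S_term b j g)"
proof -
  have b: "b > 0" using j by simp
  let ?z = "omega b ^ j"
  have z: "norm ?z = 1" "?z \<noteq> 1"
    using j by (simp_all only: omega_power_eq_cis[of b j] norm_cis)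
      (auto simp: omega_power_eq_cis[symmetric] omega_power_eq_1_iff[OF b] dest: dvd_imp_le)
  have "summable (\<lambda>m. ?z ^ Suc m * complex_of_real (g (real (Suc m) / real b)))"
  proof (rule Dirichlet_test_bounded_variation)
    show "norm (\<Sum>m<n. ?z ^ Suc m) \<le> 2 / norm (?z - 1)" for n
      using z by (rule norm_geometric_sum_le)
    have "(\<lambda>m. g (real (Suc m) / real b)) \<longlonglongrightarrow> 0"
      by (rule filterlim_compose[OF D0_K0_tendsto_at_top[OF g] filterlim_Suc_over_at_top[OF b]])
    then show "(\<lambda>m. complex_of_real (g (real (Suc m) / real b))) \<longlonglongrightarrow> 0"
      using tendsto_of_real by fastforce
    show "summable (\<lambda>m. norm (complex_of_real (g (real (Suc m) / real b)) -
        complex_of_real (g (real (Suc (Suc m)) / real b))))"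
      using D0_K0_bounded_variation[OF g b] by (simp only: of_real_diff[symmetric] norm_of_real)
  qed
  then show ?thesis by (simp only: S_term_def[abs_def] power_mult)
qed

lemma sum_twisted_S_term:
  assumes "a < b"
  shows "(\<Sum>j<b. (1 - omega b powi (- int (a * j))) * S_term b j g m) =
    of_nat b * complex_of_real (((if b dvd Suc m then 1 else 0) -
      (if b dvd Suc m + (b - a) then 1 else 0)) * g (real (Suc m) / real b))"
proof -
  have b: "b > 0" using assms by simp
  have "(\<Sum>j<b. (1 - omega b powi (- int (a * j))) * S_term b j g m) =
      ((\<Sum>j<b. omega b ^ (j * Suc m)) - (\<Sum>j<b. omega b ^ (j * (Suc m + (b - a))))) *
        complex_of_real (g (real (Suc m) / real b))"
    unfolding omega_powi_minus[OF assms] S_term_def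
    unfolding sum_subtractf[symmetric] sum_distrib_right
    by (intro sum.cong refl) (simp only: distrib_left power_add left_diff_distrib right_diff_distrib mult_1_left
        mult_1_right mult_ac)
  then show ?thesis
    unfolding sum_omega_powers[OF b] by simp
qed

text \<open>
  The term with index \<open>m\<close> belongs to \<open>k = m + 1\<close>. Among \<open>k = q * b + 1, \<dots>, q * b + b\<close> exactly
  one, \<open>(q + 1) * b\<close>, is divisible by \<open>b\<close>, and exactly one, \<open>q * b + a\<close>, is congruent to \<open>a\<close>.
\<close>

lemma root_of_unity_block:
  fixes g :: "real \<Rightarrow> real"
  assumes a: "1 \<le> a" "a < b"
  shows "(\<Sum>m\<in>{q*b..<q*b+b}. ((if b dvd Suc m then 1 else 0) -
      (if b dvd Suc m + (b - a) then 1 else 0)) * g (real (Suc m) / real b)) =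
    g (real (Suc q)) - g (real a / real b + real q)"
proof -
  have b: "b > 0" using a by simp
  let ?I = "{q*b..<q*b+b}"
  let ?v = "\<lambda>m. g (real (Suc m) / real b)"
  have unique: "m = n" if "m \<in> ?I" "n \<in> ?I" "b dvd Suc m + d" "b dvd Suc n + d" for m n d
  proof -
    have "int b dvd int (Suc m + d) - int (Suc n + d)"
      using that by (intro dvd_diff) (simp_all only: of_nat_dvd_iff)
    then have "int b dvd int m - int n" by simp
    moreover have "\<bar>int m - int n\<bar> < int b" using that by auto
    ultimately show "m = n"
      using zdvd_not_zless[of "\<bar>int m - int n\<bar>" "int b"] by fastforce
  qed
  have in_block: "q*b + (b-1) \<in> ?I" "q*b + (a-1) \<in> ?I"
    using a by (simp_all, linarith+)
  have iff_b: "b dvd Suc m \<longleftrightarrow> m = q*b + (b-1)" if "m \<in> ?I" for m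
  proof -
    have "Suc (q*b + (b-1)) = Suc q * b" using b by simp
    then have "b dvd Suc (q*b + (b-1)) + 0"
      by (simp only: dvd_triv_right add_0_right)
    with unique[OF that in_block(1), of 0] show ?thesis by auto
  qed
  have iff_a: "b dvd Suc m + (b - a) \<longleftrightarrow> m = q*b + (a-1)" if "m \<in> ?I" for m
  proof -
    have "Suc (q*b + (a-1)) + (b - a) = Suc q * b"
      using a by simp
    then have "b dvd Suc (q*b + (a-1)) + (b - a)"
      by (simp only: dvd_triv_right)
    with unique[OF that in_block(2)] show ?thesis by blast
  qed
  have "(\<Sum>m\<in>?I. ((if b dvd Suc m then 1 else 0) -
      (if b dvd Suc m + (b - a) then 1 else 0)) * ?v m) =
      (\<Sum>m\<in>?I. (if m = q*b + (b-1) then ?v m else 0) - (if m = q*b + (a-1) then ?v m else 0))"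
    by (intro sum.cong refl) (simp only: iff_b iff_a, simp)
  also have "\<dots> = ?v (q*b + (b-1)) - ?v (q*b + (a-1))"
    unfolding sum_subtractf using in_block by (simp only: sum.delta finite_atLeastLessThan if_True)
  also have "real (Suc (q*b + (b-1))) / real b = real (Suc q)"
    using b by (simp add: field_simps of_nat_diff)
  also have "real (Suc (q*b + (a-1))) / real b = real a / real b + real q"
    using a by (simp add: field_simps of_nat_diff)
  finally show ?thesis .
qed

theorem proposition8p65:
  fixes g :: "real \<Rightarrow> real" and a b :: nat
  assumes "g \<in> D0 \<inter> K0"
    and "1 \<le> a" and "a < b"
  shows "(\<forall>j\<in>{1..<b}. summable (S_term b j g)) \<and>
    complex_of_real (Sigma_fun g (real a / real b)) =
      1 / of_nat b * (\<Sum>j=0..b-1. (1 - omega b powi (- int (a * j))) * S_sum b j g)"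
proof
  show summable: "\<forall>j\<in>{1..<b}. summable (S_term b j g)"
    using summable_S_term[OF assms(1)] by auto
  have b: "b > 0" using assms by simp
  define T where "T = (\<Sum>j<b. (1 - omega b powi (- int (a * j))) * S_sum b j g)"
  define x where "x = real a / real b"
  have "(\<lambda>m. (1 - omega b powi (- int (a * j))) * S_term b j g m) sums
      ((1 - omega b powi (- int (a * j))) * S_sum b j g)" if "j < b" for j
  proof (cases "j = 0")
    case False
    with that summable have "S_term b j g sums S_sum b j g"
      by (auto simp: S_sum_def intro: summable_sums)
    then show ?thesis by (rule sums_mult)
  \<comment> \<open>For \<open>j = 0\<close> the factor is \<open>0\<close>, so both sides vanish whatever \<open>S_sum b 0 g\<close> is.\<close>
  qed simp
  then have "(\<lambda>m. \<Sum>j<b. (1 - omega b powi (- int (a * j))) * S_term b j g m) sums T"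
    unfolding T_def by (intro sums_sum) auto
  from sums_group[OF sums_divide[OF this, of "of_nat b"] b]
  have "(\<lambda>q. complex_of_real (g (real (Suc q)) - g (x + real q))) sums (T / of_nat b)"
    unfolding sum_twisted_S_term[OF assms(3)] x_def root_of_unity_block[OF assms(2,3), symmetric]
    using b by simp
  \<comment> \<open>The series is real, hence so is its sum, and the limit can be taken in the reals.\<close>
  then have re: "(\<lambda>q. complex_of_real (Re (complex_of_real (g (real (Suc q)) - g (x + real q)))))
      sums complex_of_real (Re (T / of_nat b))"
    and cx: "(\<lambda>q. complex_of_real (g (real (Suc q)) - g (x + real q))) sums (T / of_nat b)"
    by (auto simp only: sums_of_real_iff intro: sums_Re)
  have T: "complex_of_real (Re (T / of_nat b)) = T / of_nat b"
    using sums_unique2[OF re[simplified Re_complex_of_real] cx] .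
  have series: "(\<lambda>q. g (real (Suc q)) - g (x + real q)) sums Re (T / of_nat b)"
    using sums_Re[OF cx] by simp
  have partial: "- g x + (\<Sum>k=1..<n. g (real k) - g (x + real k)) =
      (\<Sum>q<n. g (real (Suc q)) - g (x + real q)) - g (real n)" if "n \<ge> 1" for n
    using that by (induction n rule: dec_induct) auto
  have "(\<lambda>n. (\<Sum>q<n. g (real (Suc q)) - g (x + real q)) - g (real n))
      \<longlonglongrightarrow> Re (T / of_nat b) - 0"
    using series assms(1) by (intro tendsto_diff) (auto simp: sums_def D0_def)
  then have "(\<lambda>n. - g x + (\<Sum>k=1..<n. g (real k) - g (x + real k))) \<longlonglongrightarrow> Re (T / of_nat b)"
    unfolding diff_zero
    by (rule Lim_transform_eventually)
       (use partial in \<open>auto intro!: eventually_sequentiallyI[of 1]\<close>)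
  then have "Sigma_fun g x = Re (T / of_nat b)"
    unfolding Sigma_fun_def by (rule limI)
  moreover have "{0..b-1} = {..<b}" using b by auto
  ultimately show "complex_of_real (Sigma_fun g (real a / real b)) =
      1 / of_nat b * (\<Sum>j=0..b-1. (1 - omega b powi (- int (a * j))) * S_sum b j g)"
    using T by (simp add: x_def T_def)
qed

end
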